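(* Let $\psi:T\to\mathbb{C}$ be such that $M_\psi$ is a bounded multiplication operator from $\mathcal{L}$ to $\mathcal{L}_{\mathbf{w}}$, and define $$\mathcal{A}(\psi)=\lim_{n\to\infty}\sup_{|v|\ge n}|v||\psi(v)|,\qquad \mathcal{B}(\psi)=\lim_{n\to\infty}\sup_{|v|\ge n}|v|^2D\psi(v).$$ Then $$\|M_\psi\|_e\ge\max\left\{\mathcal{A}(\psi),\tfrac12\mathcal{B}(\psi)\right\}.$$
   Context: $T$ is the vertex set of a tree (a locally finite, connected, simply connected graph), rooted at a vertex $o$ and without terminal vertices (a terminal vertex is one having a unique neighbor), hence infinite. $|v|$ is the number of edges in the path from $o$ to $v$; $T^*=T\setminus\{o\}$; for $v\in T^*$, $v^-$ is the neighbor of $v$ closest to $o$. For $f:T\to\mathbb{C}$ and $v\in T^*$, $Df(v)=|f(v)-f(v^-)|$. The Lipschitz space $\mathcal{L}$ is the Banach space of all $f:T\to\mathbb{C}$ with $\sup_{v\in T^*}Df(v)<\infty$, with norm $\|f\|_{\mathcal{L}}=|f(o)|+\sup_{v\in T^*}Df(v)$. The weighted Lipschitz space $\mathcal{L}_{\mathbf{w}}$ is the Banach space of all $f:T\to\mathbb{C}$ with $\sup_{v\in T^*}|v|Df(v)<\infty$, with norm $\|f\|_{\mathbf{w}}=|f(o)|+\sup_{v\in T^*}|v|Df(v)$. For $\psi:T\to\mathbb{C}$, $M_\psi f=\psi f$ (pointwise product). "$M_\psi:X\to Y$ is bounded" means that $\psi f\in Y$ for all $f\in X$ and $M_\psi$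 is a bounded linear operator. The essential norm of a bounded operator $S:X\to Y$ between Banach spaces is $\|S\|_e=\inf\{\|S-K\|:K\text{ is a compact operator from }X\text{ to }Y\}$. *)

theory Defs
  imports "HOL-Analysis.Analysis"
begin

section \<open>Bounded and compact operators between normed spaces of functions\<close>

text \<open>
  A complex normed space of functions is given by a carrier X, a set of functions
  closed under pointwise linear combinations, and a norm nX, of which only the values on X
  matter. An operator is a total HOL function, of which only the restriction to X matters.
\<close>

definition linear_operator ::
  "('a \<Rightarrow> complex) set \<Rightarrow> ('b \<Rightarrow> complex) set \<Rightarrow> (('a \<Rightarrow> complex) \<Rightarrow> 'b \<Rightarrow> complex) \<Rightarrow> bool" where
  "linear_operator X Y S \<longleftrightarrow>
     (\<forall>f\<in>X. S f \<in> Y) \<and>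
     (\<forall>f\<in>X. \<forall>g\<in>X. S (\<lambda>x. f x + g x) = (\<lambda>y. S f y + S g y)) \<and>
     (\<forall>c. \<forall>f\<in>X. S (\<lambda>x. c * f x) = (\<lambda>y. c * S f y))"

definition bounded_operator ::
  "('a \<Rightarrow> complex) set \<Rightarrow> (('a \<Rightarrow> complex) \<Rightarrow> real) \<Rightarrow>
   ('b \<Rightarrow> complex) set \<Rightarrow> (('b \<Rightarrow> complex) \<Rightarrow> real) \<Rightarrow>
   (('a \<Rightarrow> complex) \<Rightarrow> 'b \<Rightarrow> complex) \<Rightarrow> bool" where
  "bounded_operator X nX Y nY S \<longleftrightarrow>
     linear_operator X Y S \<and> (\<exists>C. \<forall>f\<in>X. nY (S f) \<le> C * nX f)"

definition operator_norm ::
  "('a \<Rightarrow> complex) set \<Rightarrow> (('a \<Rightarrow> complex) \<Rightarrow> real) \<Rightarrow> (('b \<Rightarrow> complex) \<Rightarrow> real) \<Rightarrow>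
   (('a \<Rightarrow> complex) \<Rightarrow> 'b \<Rightarrow> complex) \<Rightarrow> real" where
  "operator_norm X nX nY S = (SUP f\<in>{f \<in> X. nX f \<le> 1}. nY (S f))"

text \<open>
  The distance is cut off outside Y because the locale \<^locale>\<open>Metric_space\<close> requires
  nonnegativity and symmetry of the distance on the whole type.
\<close>

definition norm_distance ::
  "('b \<Rightarrow> complex) set \<Rightarrow> (('b \<Rightarrow> complex) \<Rightarrow> real) \<Rightarrow> ('b \<Rightarrow> complex) \<Rightarrow> ('b \<Rightarrow> complex) \<Rightarrow> real" where
  "norm_distance Y nY f g = (if f \<in> Y \<and> g \<in> Y then nY (\<lambda>y. f y - g y) else 0)"

definition norm_topology ::
  "('b \<Rightarrow> complex) set \<Rightarrow> (('b \<Rightarrow> complex) \<Rightarrow> real) \<Rightarrow> ('b \<Rightarrow> complex) topology" where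
  "norm_topology Y nY = Metric_space.mtopology Y (norm_distance Y nY)"

definition compact_operator ::
  "('a \<Rightarrow> complex) set \<Rightarrow> (('a \<Rightarrow> complex) \<Rightarrow> real) \<Rightarrow>
   ('b \<Rightarrow> complex) set \<Rightarrow> (('b \<Rightarrow> complex) \<Rightarrow> real) \<Rightarrow>
   (('a \<Rightarrow> complex) \<Rightarrow> 'b \<Rightarrow> complex) \<Rightarrow> bool" where
  "compact_operator X nX Y nY K \<longleftrightarrow>
     bounded_operator X nX Y nY K \<and>
     (\<forall>B\<subseteq>X. (\<exists>C. \<forall>f\<in>B. nX f \<le> C) \<longrightarrow>
        compactin (norm_topology Y nY) (norm_topology Y nY closure_of (K ` B)))"

definition essential_norm ::
  "('a \<Rightarrow> complex) set \<Rightarrow> (('a \<Rightarrow> complex) \<Rightarrow> real) \<Rightarrow>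
   ('b \<Rightarrow> complex) set \<Rightarrow> (('b \<Rightarrow> complex) \<Rightarrow> real) \<Rightarrow>
   (('a \<Rightarrow> complex) \<Rightarrow> 'b \<Rightarrow> complex) \<Rightarrow> real" where
  "essential_norm X nX Y nY S =
     Inf {operator_norm X nX nY (\<lambda>f y. S f y - K f y) |K. compact_operator X nX Y nY K}"

definition mult_operator :: "('v \<Rightarrow> complex) \<Rightarrow> ('v \<Rightarrow> complex) \<Rightarrow> 'v \<Rightarrow> complex" where
  "mult_operator \<psi> f = (\<lambda>v. \<psi> v * f v)"


section \<open>Rooted trees\<close>

text \<open>
  The vertex set is the whole type. A connected graph is simply connected iff it has no cycle,
  a cycle being a closed walk through at least three vertices, all distinct.
  The one-vertex tree has no terminal vertex either; it is excluded by requiring infinitely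
  many vertices.
\<close>

locale leafless_tree =
  fixes adj :: "'v \<Rightarrow> 'v \<Rightarrow> bool"
  assumes irreflexive: "\<not> adj v v"
    and symmetric: "adj u v \<Longrightarrow> adj v u"
    and locally_finite: "finite {w. adj v w}"
    and connected: "adj\<^sup>*\<^sup>* u v"
    and acyclic: "\<not> (\<exists>p. length p \<ge> 3 \<and> distinct p \<and> successively adj p \<and> adj (last p) (hd p))"
    and no_terminal: "\<not> (\<exists>!w. adj v w)"
    and infinite_vertices: "infinite (UNIV :: 'v set)"

locale rooted_tree = leafless_tree adj for adj :: "'v \<Rightarrow> 'v \<Rightarrow> bool" +
  fixes root :: 'v
begin

definition path_between :: "'v \<Rightarrow> 'v \<Rightarrow> 'v list" where
  "path_between u v =
     (THE p. p \<noteq> [] \<and> hd p = u \<and> last p = v \<and> distinct p \<and> successively adj p)"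

definition vlen :: "'v \<Rightarrow> nat" where
  "vlen v = length (path_between root v) - 1"

definition parent :: "'v \<Rightarrow> 'v" where
  "parent v = (ARG_MIN vlen w. adj v w)"

text \<open>
  Meaningful for v other than the root only. Where the root is not excluded explicitly below,
  the derivative carries the factor vlen v, which vanishes at the root.
\<close>

definition D :: "('v \<Rightarrow> complex) \<Rightarrow> 'v \<Rightarrow> real" where
  "D f v = cmod (f v - f (parent v))"

definition lipschitz_space :: "('v \<Rightarrow> complex) set" where
  "lipschitz_space = {f. bdd_above ((\<lambda>v. D f v) ` (UNIV - {root}))}"

definition lipschitz_norm :: "('v \<Rightarrow> complex) \<Rightarrow> real" where
  "lipschitz_norm f = cmod (f root) + (SUP v\<in>UNIV - {root}. D f v)"

definition weighted_lipschitz_space :: "('v \<Rightarrow> complex) set" where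
  "weighted_lipschitz_space = {f. bdd_above ((\<lambda>v. real (vlen v) * D f v) ` (UNIV - {root}))}"

definition weighted_lipschitz_norm :: "('v \<Rightarrow> complex) \<Rightarrow> real" where
  "weighted_lipschitz_norm f = cmod (f root) + (SUP v\<in>UNIV - {root}. real (vlen v) * D f v)"

text \<open>
  The two quantities below live in the extended reals, so that the suprema and the limits of
  the decreasing sequences exist for every function.
\<close>

definition \<A> :: "('v \<Rightarrow> complex) \<Rightarrow> ereal" where
  "\<A> \<psi> = lim (\<lambda>n. SUP v\<in>{v. vlen v \<ge> n}. ereal (real (vlen v) * cmod (\<psi> v)))"

definition \<B> :: "('v \<Rightarrow> complex) \<Rightarrow> ereal" where
  "\<B> \<psi> = lim (\<lambda>n. SUP v\<in>{v. vlen v \<ge> n}. ereal ((real (vlen v))\<^sup>2 * D \<psi> v))"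

end

end

theory Submission
  imports Defs
begin

text \<open>
  If all finite sums of a sequence in X stay in a fixed ball, then a compact operator K cannot
  be bounded below along it: images clustering at a nonzero g would make the sum of P of
  them about P g, contradicting the boundedness of K. So every lower bound for the norms
  of the images under S of such a sequence in the unit ball bounds the essential norm of S from below.

  In the Lipschitz space such sequences are given by radial functions whose profiles have slope
  at most 1 and supports in consecutive ranges of levels. The indicator of the level of v yields the
  quantity \<open>\<A>\<close>; a trapezoidal profile that is constant, with value at least half the level of v,
  along the edge from v to its parent yields half of \<open>\<B>\<close>.
\<close>

section \<open>Normed spaces of functions\<close>

text \<open>The axioms bound norms from above because that is what estimates of suprema give
  directly; nonnegativity, symmetry and the homogeneity used later follow from them. As in the
  definitions, \<open>nX\<close> matters on \<open>X\<close> only.\<close>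

locale normed_function_space =
  fixes X :: "('a \<Rightarrow> complex) set" and nX :: "('a \<Rightarrow> complex) \<Rightarrow> real"
  assumes zero_mem: "(\<lambda>_. 0) \<in> X"
    and add_mem: "f \<in> X \<Longrightarrow> g \<in> X \<Longrightarrow> (\<lambda>x. f x + g x) \<in> X"
    and scale_mem: "f \<in> X \<Longrightarrow> (\<lambda>x. c * f x) \<in> X"
    and norm_add_le: "f \<in> X \<Longrightarrow> g \<in> X \<Longrightarrow> nX (\<lambda>x. f x + g x) \<le> nX f + nX g"
    and norm_scale_le: "f \<in> X \<Longrightarrow> nX (\<lambda>x. c * f x) \<le> cmod c * nX f"
    and norm_le_0_imp: "f \<in> X \<Longrightarrow> nX f \<le> 0 \<Longrightarrow> f = (\<lambda>_. 0)"
begin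

lemma norm_zero: "nX (\<lambda>_. 0) = 0"
proof -
  have "nX (\<lambda>_. 0) \<le> 0" "nX (\<lambda>_. 0) \<le> nX (\<lambda>_. 0) + nX (\<lambda>_. 0)"
    using norm_scale_le[OF zero_mem, of 0] norm_add_le[OF zero_mem zero_mem] by simp_all
  then show ?thesis by simp
qed

lemma minus_mem: "f \<in> X \<Longrightarrow> (\<lambda>x. - f x) \<in> X"
  using scale_mem[of f "-1"] by simp

lemma norm_minus: "f \<in> X \<Longrightarrow> nX (\<lambda>x. - f x) = nX f"
  using norm_scale_le[of f "-1"] norm_scale_le[of "\<lambda>x. - f x" "-1"] minus_mem[of f] by simp

lemma norm_nonneg: "f \<in> X \<Longrightarrow> 0 \<le> nX f"
  using norm_add_le[OF _ minus_mem, of f f] norm_zero norm_minus[of f] by simp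

lemma diff_mem: "f \<in> X \<Longrightarrow> g \<in> X \<Longrightarrow> (\<lambda>x. f x - g x) \<in> X"
  using add_mem[OF _ minus_mem, of f g] by simp

lemma norm_diff_le: "f \<in> X \<Longrightarrow> g \<in> X \<Longrightarrow> nX (\<lambda>x. f x - g x) \<le> nX f + nX g"
  using norm_add_le[OF _ minus_mem, of f g] norm_minus[of g] by simp

lemma norm_diff_commute: "f \<in> X \<Longrightarrow> g \<in> X \<Longrightarrow> nX (\<lambda>x. f x - g x) = nX (\<lambda>x. g x - f x)"
  using norm_minus[OF diff_mem, of f g] by simp

lemma norm_triangle:
  assumes "f \<in> X" "g \<in> X" "h \<in> X"
  shows "nX (\<lambda>x. f x - h x) \<le> nX (\<lambda>x. f x - g x) + nX (\<lambda>x. g x - h x)"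
  using norm_add_le[OF diff_mem[OF assms(1,2)] diff_mem[OF assms(2,3)]] by simp

text \<open>The lower bound comes from undoing the scaling with the factor
  \<open>1 / of_nat n\<close>. It makes the norm of \<open>P\<close> copies of one function grow
  linearly in \<open>P\<close>.\<close>

lemma norm_eq_scale_nat:
  assumes "f \<in> X"
  shows "nX (\<lambda>x. of_nat n * f x) = real n * nX f"
proof (cases "n = 0")
  case True
  then show ?thesis by (simp add: norm_zero)
next
  case False
  then have "nX f \<le> nX (\<lambda>x. of_nat n * f x) / real n"
    using norm_scale_le[OF scale_mem[OF assms, of "of_nat n"], of "1 / of_nat n"]
    by (simp add: norm_divide)
  moreover have "nX (\<lambda>x. of_nat n * f x) \<le> real n * nX f"
    using norm_scale_le[OF assms, of "of_nat n"] by simp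
  ultimately show ?thesis using False by (simp add: field_simps)
qed

lemma sum_mem: "(\<And>i. i \<in> I \<Longrightarrow> f i \<in> X) \<Longrightarrow> (\<lambda>x. \<Sum>i\<in>I. f i x) \<in> X"
  by (induction I rule: infinite_finite_induct) (auto simp: zero_mem intro!: add_mem)

lemma norm_sum_le:
  "(\<And>i. i \<in> I \<Longrightarrow> f i \<in> X) \<Longrightarrow> nX (\<lambda>x. \<Sum>i\<in>I. f i x) \<le> (\<Sum>i\<in>I. nX (f i))"
proof (induction I rule: infinite_finite_induct)
  case (insert i I)
  have "nX (\<lambda>x. f i x + (\<Sum>i\<in>I. f i x)) \<le> nX (f i) + nX (\<lambda>x. \<Sum>i\<in>I. f i x)"
    using insert.prems by (intro norm_add_le sum_mem) auto
  then show ?case using insert by fastforce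
qed (simp_all add: norm_zero)

lemma Metric_space_norm_distance: "Metric_space X (norm_distance X nX)"
proof
  show "0 \<le> norm_distance X nX f g" for f g
    by (simp add: norm_distance_def norm_nonneg diff_mem)
  show "norm_distance X nX f g = norm_distance X nX g f" for f g
    using norm_diff_commute[of f g] by (auto simp: norm_distance_def)
  show "norm_distance X nX f g = 0 \<longleftrightarrow> f = g" if "f \<in> X" "g \<in> X" for f g
    using that norm_le_0_imp[OF diff_mem, of f g]
    by (auto simp: norm_distance_def norm_zero fun_eq_iff)
  show "norm_distance X nX f h \<le> norm_distance X nX f g + norm_distance X nX g h"
    if "f \<in> X" "g \<in> X" "h \<in> X" for f g h
    using that by (simp add: norm_distance_def norm_triangle)
qed

sublocale metric: Metric_space X "norm_distance X nX"
  by (rule Metric_space_norm_distance)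

end

section \<open>Compact operators and lower bounds for the essential norm\<close>

lemma compact_operator_zero:
  assumes "normed_function_space X nX" "normed_function_space Y nY"
  shows "compact_operator X nX Y nY (\<lambda>_ _. 0)"
proof -
  interpret X: normed_function_space X nX by fact
  interpret Y: normed_function_space Y nY by fact
  have "\<forall>f\<in>X. nY (\<lambda>_. 0) \<le> 0 * nX f" by (simp add: Y.norm_zero)
  then have "bounded_operator X nX Y nY (\<lambda>_ _. 0)"
    unfolding bounded_operator_def linear_operator_def using Y.zero_mem by (intro conjI exI[of _ 0]) auto
  moreover have "compactin (norm_topology Y nY) (norm_topology Y nY closure_of ((\<lambda>_ _. 0) ` B))"
    for B :: "('a \<Rightarrow> complex) set"
  proof -
    \<comment> \<open>Only an inclusion, since \<open>B\<close> may be empty. Singletons are closed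
      in a Hausdorff space, so the closure has at most one element.\<close>
    have "Y.metric.mtopology closure_of ((\<lambda>_ _. 0) ` B) \<subseteq> Y.metric.mtopology closure_of {\<lambda>_. 0}"
      by (intro closure_of_mono) auto
    also have "\<dots> = {\<lambda>_. 0}"
      using Y.metric.Hausdorff_space_mtopology Y.zero_mem
      by (intro closure_of_closedin) (simp add: Hausdorff_imp_t1_space closedin_t1_singleton)
    finally have "finite (Y.metric.mtopology closure_of ((\<lambda>_ _. 0) ` B))"
      using finite_subset by blast
    then show ?thesis
      unfolding norm_topology_def
      by (intro finite_imp_compactin closure_of_subset_topspace)
  qed
  ultimately show ?thesis unfolding compact_operator_def by blast
qed

lemma linear_operator_sum:
  assumes "normed_function_space X nX" "linear_operator X Y S" "finite I" "\<And>i. i \<in> I \<Longrightarrow> f i \<in> X"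
  shows "S (\<lambda>x. \<Sum>i\<in>I. f i x) = (\<lambda>y. \<Sum>i\<in>I. S (f i) y)"
  using assms(3,4)
proof (induction I)
  case empty
  interpret X: normed_function_space X nX by fact
  have "\<forall>c. \<forall>f\<in>X. S (\<lambda>x. c * f x) = (\<lambda>y. c * S f y)"
    using assms(2) unfolding linear_operator_def by blast
  \<comment> \<open>Homogeneity with factor 0 gives the value at the zero function.\<close>
  from bspec[OF spec[OF this, of 0] X.zero_mem] show ?case by simp
next
  case (insert i I)
  interpret X: normed_function_space X nX by fact
  have "S (\<lambda>x. f i x + (\<Sum>i\<in>I. f i x)) = (\<lambda>y. S (f i) y + S (\<lambda>x. \<Sum>i\<in>I. f i x) y)"
    using assms(2) X.sum_mem[of I f] insert.prems unfolding linear_operator_def by simp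
  with insert show ?case by simp
qed

text \<open>Bounded finite sums make the sequence weakly null, and compact operators map weakly null
  sequences to norm null ones. Summing images directly avoids linear functionals.\<close>

lemma compact_operator_small_value:
  assumes "normed_function_space X nX" "normed_function_space Y nY"
    and K: "compact_operator X nX Y nY K"
    and f: "\<And>n :: nat. f n \<in> X"
    and C: "\<And>I. finite I \<Longrightarrow> nX (\<lambda>x. \<Sum>n\<in>I. f n x) \<le> C"
    and e: "e > 0"
  shows "\<exists>n. nY (K (f n)) < e"
proof (rule ccontr)
  interpret X: normed_function_space X nX by fact
  interpret Y: normed_function_space Y nY by fact
  assume "\<not> ?thesis"
  then have ge: "e \<le> nY (K (f n))" for n by (simp add: not_less)
  obtain C' where lin: "linear_operator X Y K" and C': "\<And>f. f \<in> X \<Longrightarrow> nY (K f) \<le> C' * nX f"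
    using K unfolding compact_operator_def bounded_operator_def by blast
  have KY: "K (f n) \<in> Y" for n using lin f unfolding linear_operator_def by blast
  \<comment> \<open>Singleton index sets turn the bound on sums into boundedness of the sequence
    itself.\<close>
  have "\<forall>g\<in>range f. nX g \<le> C" using C[of "{n}" for n] by auto
  then have cpt: "compactin Y.metric.mtopology (Y.metric.mtopology closure_of (K ` range f))"
    using K f unfolding compact_operator_def norm_topology_def by blast
  have "range (\<lambda>n. K (f n)) \<subseteq> Y.metric.mtopology closure_of (K ` range f)"
    using closure_of_subset[of "K ` range f" Y.metric.mtopology] KY by auto
  then obtain g r where r: "strict_mono (r :: nat \<Rightarrow> nat)"
      and "limitin Y.metric.mtopology ((\<lambda>n. K (f n)) \<circ> r) g sequentially"
    using cpt unfolding Y.metric.compactin_sequentially by blast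
  then have g: "g \<in> Y" and "\<forall>\<^sub>F n in sequentially. norm_distance Y nY (K (f (r n))) g < e / 4"
    using e unfolding Y.metric.limitin_metric by (auto elim!: allE[of _ "e / 4"] eventually_mono)
  then obtain N where N: "\<And>n. n \<ge> N \<Longrightarrow> nY (\<lambda>y. K (f (r n)) y - g y) < e / 4"
    using KY g unfolding eventually_sequentially norm_distance_def by auto
  have "e \<le> nY (\<lambda>y. K (f (r N)) y - g y) + nY g"
    using ge[of "r N"] Y.norm_add_le[OF Y.diff_mem[OF KY g] g, of "r N"] by simp
  then have ng: "nY g > 3 / 4 * e" using N[of N] by simp
  \<comment> \<open>The sum of \<open>P\<close> images is within \<open>P * e / 4\<close> of
    \<open>P\<close> times \<open>g\<close>, whose norm is at least \<open>3 / 4 * P * e\<close>. So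
    the sum has norm at least \<open>P * e / 2\<close>, while boundedness of \<open>K\<close> caps
    it independently of \<open>P\<close>.\<close>
  have bound: "real P * (e / 2) \<le> \<bar>C'\<bar> * C" for P
  proof -
    define I where "I = {N..<N + P}"
    define s where "s = (\<lambda>y. \<Sum>n\<in>I. K (f (r n)) y)"
    have sY: "s \<in> Y" unfolding s_def by (intro Y.sum_mem KY)
    have inj: "inj_on r I" using r by (meson inj_on_subset strict_mono_imp_inj_on subset_UNIV)
    have s_eq: "s = K (\<lambda>x. \<Sum>n\<in>r ` I. f n x)"
      using linear_operator_sum[OF assms(1) lin, of "r ` I" f] f inj
      by (simp add: s_def sum.reindex I_def)
    have "nY s \<le> C' * nX (\<lambda>x. \<Sum>n\<in>r ` I. f n x)"
      unfolding s_eq by (intro C' X.sum_mem f)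
    \<comment> \<open>The sign of \<open>C'\<close> is unknown; monotonicity in the norm needs a
      nonnegative factor.\<close>
    also have "\<dots> \<le> \<bar>C'\<bar> * nX (\<lambda>x. \<Sum>n\<in>r ` I. f n x)"
      by (intro mult_right_mono X.norm_nonneg X.sum_mem f) auto
    also have "\<dots> \<le> \<bar>C'\<bar> * C"
      by (intro mult_left_mono C) (auto simp: I_def)
    finally have s_le: "nY s \<le> \<bar>C'\<bar> * C" .
    have "(\<lambda>y. \<Sum>n\<in>I. K (f (r n)) y - g y) = (\<lambda>y. s y - of_nat P * g y)"
      by (simp add: s_def sum_subtractf I_def)
    moreover have "nY (\<lambda>y. \<Sum>n\<in>I. K (f (r n)) y - g y) \<le> (\<Sum>n\<in>I. nY (\<lambda>y. K (f (r n)) y - g y))"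
      by (intro Y.norm_sum_le Y.diff_mem KY g)
    moreover have "\<dots> \<le> (\<Sum>n\<in>I. e / 4)"
      by (rule sum_mono, rule less_imp_le, rule N) (simp add: I_def)
    ultimately have "nY (\<lambda>y. s y - of_nat P * g y) \<le> real P * (e / 4)"
      by (simp add: I_def)
    moreover have "nY (\<lambda>y. of_nat P * g y) \<le> nY s + nY (\<lambda>y. s y - of_nat P * g y)"
      using Y.norm_diff_le[OF sY Y.diff_mem[OF sY Y.scale_mem[OF g]], of "of_nat P"] by simp
    moreover have "real P * (3 / 4 * e) \<le> real P * nY g" using ng by (intro mult_left_mono) auto
    ultimately show ?thesis
      using s_le Y.norm_eq_scale_nat[OF g, of P] by (simp add: algebra_simps)
  qed
  obtain P :: nat where "\<bar>C'\<bar> * C / (e / 2) < real P" using reals_Archimedean2 by blast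
  then show False using bound[of P] e by (simp add: field_simps)
qed

text \<open>For compact \<open>K\<close>, choose an index where \<open>K\<close> is nearly zero:
  there \<open>S - K\<close> is nearly as large as \<open>S\<close>, at a point of the unit ball.
  This bounds every member of the infimum.\<close>

lemma essential_norm_ge:
  assumes X: "normed_function_space X nX" and Y: "normed_function_space Y nY"
    and S: "bounded_operator X nX Y nY S"
    and f: "\<And>n :: nat. f n \<in> X" "\<And>n. nX (f n) \<le> 1"
    and C: "\<And>I. finite I \<Longrightarrow> nX (\<lambda>x. \<Sum>n\<in>I. f n x) \<le> C"
    and L: "\<And>n. L \<le> nY (S (f n))"
  shows "L \<le> essential_norm X nX Y nY S"
  unfolding essential_norm_def
proof (rule cInf_greatest)
  \<comment> \<open>The infimum of reals is informative only over a nonempty set; the zero operator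
    provides a member.\<close>
  show "{operator_norm X nX nY (\<lambda>f y. S f y - K f y) |K. compact_operator X nX Y nY K} \<noteq> {}"
    using compact_operator_zero[OF X Y] by blast
next
  interpret X: normed_function_space X nX by fact
  interpret Y: normed_function_space Y nY by fact
  fix a assume "a \<in> {operator_norm X nX nY (\<lambda>f y. S f y - K f y) |K. compact_operator X nX Y nY K}"
  then obtain K where K: "compact_operator X nX Y nY K"
    and a: "a = operator_norm X nX nY (\<lambda>f y. S f y - K f y)" by blast
  obtain CS where SY: "\<And>f. f \<in> X \<Longrightarrow> S f \<in> Y" and CS: "\<And>f. f \<in> X \<Longrightarrow> nY (S f) \<le> CS * nX f"
    using S unfolding bounded_operator_def linear_operator_def by blast
  obtain CK where KY: "\<And>f. f \<in> X \<Longrightarrow> K f \<in> Y" and CK: "\<And>f. f \<in> X \<Longrightarrow> nY (K f) \<le> CK * nX f"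
    using K[unfolded compact_operator_def, THEN conjunct1]
    unfolding bounded_operator_def linear_operator_def by blast
  have unit: "c * nX g \<le> \<bar>c\<bar>" if "g \<in> X" "nX g \<le> 1" for c g
    using mult_mono[of c "\<bar>c\<bar>" "nX g" 1] that X.norm_nonneg by simp
  \<comment> \<open>A real supremum dominates its members only once they are bounded above; here
    this is the boundedness of \<open>S\<close> and \<open>K\<close>.\<close>
  have bdd: "bdd_above ((\<lambda>g. nY (\<lambda>y. S g y - K g y)) ` {g \<in> X. nX g \<le> 1})"
  proof (rule bdd_aboveI2)
    fix g assume "g \<in> {g \<in> X. nX g \<le> 1}"
    then show "nY (\<lambda>y. S g y - K g y) \<le> \<bar>CS\<bar> + \<bar>CK\<bar>"
      using Y.norm_diff_le[OF SY KY, of g g] CS[of g] CK[of g] unit[of g CS] unit[of g CK] by simp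
  qed
  show "L \<le> a"
  proof (rule field_le_epsilon)
    fix e :: real assume "e > 0"
    then obtain n where n: "nY (K (f n)) < e"
      using compact_operator_small_value[OF X Y K f(1) C] by blast
    have "nY (S (f n)) \<le> nY (\<lambda>y. S (f n) y - K (f n) y) + nY (K (f n))"
      using Y.norm_add_le[OF Y.diff_mem[OF SY KY] KY, of "f n" "f n" "f n"] f(1) by simp
    moreover have "nY (\<lambda>y. S (f n) y - K (f n) y) \<le> a"
      unfolding a operator_norm_def using bdd f by (intro cSUP_upper) auto
    ultimately show "L \<le> a + e" using L[of n] n by simp
  qed
qed

section \<open>Distances in the tree\<close>

text \<open>Loops are erased as the walk grows: on reaching a vertex already visited, the path is
  cut back to it. The relation tests only the targets of steps, hence the separate assumption on
  \<open>a\<close>.\<close>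

lemma rtranclp_imp_simple_path:
  assumes "(\<lambda>x y. adj x y \<and> P y)\<^sup>*\<^sup>* a b" and "P a"
  shows "\<exists>p. p \<noteq> [] \<and> hd p = a \<and> last p = b \<and> distinct p \<and> successively adj p \<and> (\<forall>x\<in>set p. P x)"
  using assms(1)
proof (induction rule: rtranclp_induct)
  case base
  then show ?case using assms(2) by (intro exI[of _ "[a]"]) auto
next
  case (step b c)
  then obtain p where p: "p \<noteq> []" "hd p = a" "last p = b" "distinct p" "successively adj p" "\<forall>x\<in>set p. P x"
    by blast
  show ?case
  proof (cases "c \<in> set p")
    case True
    then obtain xs ys where "p = xs @ c # ys" by (meson split_list)
    moreover from this p have "hd (xs @ [c]) = a" by (cases xs) auto
    ultimately show ?thesis using p
      by (intro exI[of _ "xs @ [c]"]) (auto simp: successively_append_iff)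
  next
    case False
    with p step show ?thesis
      by (intro exI[of _ "p @ [c]"]) (auto simp: successively_append_iff)
  qed
qed

text \<open>Reachability that remembers the avoided vertex \<open>u\<close> lets two paths be joined
  by transitivity.\<close>

lemma successively_imp_rtranclp:
  assumes "successively adj p" "p \<noteq> []" "u \<notin> set p"
  shows "(\<lambda>x y. adj x y \<and> y \<noteq> u)\<^sup>*\<^sup>* (hd p) (last p)"
  using assms
proof (induction p rule: induct_list012)
  case (3 x y zs)
  then have "(\<lambda>x y. adj x y \<and> y \<noteq> u)\<^sup>*\<^sup>* y (last (y # zs))" by simp
  moreover have "adj x y \<and> y \<noteq> u" using 3 by auto
  ultimately show ?case
    by (metis (mono_tags, lifting) converse_rtranclp_into_rtranclp last_ConsR list.distinct(1) list.sel(1))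
qed auto

section \<open>Existence and uniqueness of simple paths\<close>

context leafless_tree
begin

text \<open>The predicate inside the definite description in \<open>path_between\<close>.\<close>

definition simple_path :: "'v \<Rightarrow> 'v \<Rightarrow> 'v list \<Rightarrow> bool" where
  "simple_path u v p \<longleftrightarrow> p \<noteq> [] \<and> hd p = u \<and> last p = v \<and> distinct p \<and> successively adj p"

lemma simple_path_exists: "\<exists>p. simple_path u v p"
  using rtranclp_imp_simple_path[of adj "\<lambda>_. True" u v] connected by (auto simp: simple_path_def)

text \<open>Two paths leaving \<open>u\<close> by different neighbors would join these neighbors
  through \<open>v\<close> without meeting \<open>u\<close>, and \<open>u\<close> would close a
  cycle. So the first steps agree, and induction handles the tails.\<close>

lemma simple_path_unique:
  assumes "simple_path u v p" "simple_path u v q"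
  shows "p = q"
  using assms
proof (induction p arbitrary: u q)
  case Nil
  then show ?case by (simp add: simple_path_def)
next
  case (Cons x p)
  then obtain q' where q: "q = u # q'" and x: "x = u"
    by (metis hd_Cons_tl list.sel(1) simple_path_def)
  \<comment> \<open>By distinctness a path from \<open>u\<close> back to \<open>u\<close> is
    trivial, so both tails are empty or neither is.\<close>
  have nil_iff: "r = [] \<longleftrightarrow> u = v" if "simple_path u v (u # r)" for r
    using that by (auto simp: simple_path_def split: if_splits)
  show ?case
  proof (cases "p = []")
    case True
    then show ?thesis using Cons.prems nil_iff q x by metis
  next
    case False
    then have q': "q' \<noteq> []" using Cons.prems nil_iff q x by metis
    have p_props: "last p = v" "distinct p" "successively adj p" "u \<notin> set p" "adj u (hd p)"
      using Cons.prems(1) False x by (auto simp: simple_path_def successively_Cons)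
    have q_props: "last q' = v" "distinct q'" "successively adj q'" "u \<notin> set q'" "adj u (hd q')"
      using Cons.prems(2) q' q by (auto simp: simple_path_def successively_Cons)
    have "hd p = hd q'"
    proof (rule ccontr)
      assume neq: "hd p \<noteq> hd q'"
      have 1: "(\<lambda>x y. adj x y \<and> y \<noteq> u)\<^sup>*\<^sup>* (hd p) v"
        using successively_imp_rtranclp[of adj p u] p_props False by simp
      \<comment> \<open>Traversing the second path backwards continues the walk from
        \<open>v\<close> to the other neighbor of \<open>u\<close>.\<close>
      have "successively adj (rev q')"
        unfolding successively_rev
        using q_props(3) by (rule successively_mono) (auto intro: symmetric)
      then have 2: "(\<lambda>x y. adj x y \<and> y \<noteq> u)\<^sup>*\<^sup>* v (hd q')"
        using successively_imp_rtranclp[of adj "rev q'" u] q_props q'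
        by (simp add: hd_rev last_rev)
      have "hd p \<noteq> u" using p_props False hd_in_set by metis
      then obtain r where r: "r \<noteq> []" "hd r = hd p" "last r = hd q'" "distinct r"
          "successively adj r" "u \<notin> set r"
        using rtranclp_imp_simple_path[OF rtranclp_trans[OF 1 2]] by blast
      \<comment> \<open>The ends of \<open>r\<close> differ; adding \<open>u\<close> gives the three
        vertices that a cycle requires.\<close>
      have "length r \<ge> 2"
        using r neq by (cases r; cases "tl r") auto
      then have "length (u # r) \<ge> 3 \<and> distinct (u # r) \<and> successively adj (u # r) \<and>
          adj (last (u # r)) (hd (u # r))"
        using r p_props q_props symmetric by (auto simp: successively_Cons)
      then show False using acyclic by blast
    qed
    then have "p = q'"
      using Cons.IH[of "hd p" q'] p_props q_props False q' by (auto simp: simple_path_def)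
    then show ?thesis using q x by simp
  qed
qed

end

section \<open>Levels and parents\<close>

context rooted_tree
begin

lemma vlen_eq:
  assumes "simple_path root v p"
  shows "vlen v = length p - 1"
proof -
  have "path_between root v = p"
    unfolding path_between_def
    by (rule the_equality) (use assms simple_path_unique in \<open>auto simp: simple_path_def\<close>)
  then show ?thesis by (simp add: vlen_def)
qed

lemma vlen_root: "vlen root = 0"
proof -
  have "simple_path root root [root]" by (simp add: simple_path_def)
  from vlen_eq[OF this] show ?thesis by simp
qed

text \<open>The path to \<open>w\<close> either is extended by \<open>v\<close> or already contains
  \<open>v\<close> and is cut there.\<close>

lemma vlen_adj_le:
  assumes "adj w v"
  shows "vlen v \<le> Suc (vlen w)"
proof -
  obtain p where p: "simple_path root w p" using simple_path_exists by blast
  show ?thesis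
  proof (cases "v \<in> set p")
    case True
    then obtain xs ys where xs: "p = xs @ v # ys" by (meson split_list)
    moreover from this p have "hd (xs @ [v]) = root" by (cases xs) (auto simp: simple_path_def)
    ultimately have "simple_path root v (xs @ [v])" using p
      by (auto simp: simple_path_def successively_append_iff)
    from vlen_eq[OF this] vlen_eq[OF p] xs show ?thesis by simp
  next
    case False
    with p assms have "simple_path root v (p @ [v])"
      by (auto simp: simple_path_def successively_append_iff)
    from vlen_eq[OF this] vlen_eq[OF p] p show ?thesis by (auto simp: simple_path_def)
  qed
qed

text \<open>The last vertex before \<open>v\<close> on its path is a neighbor one level lower, and
  by \<open>vlen_adj_le\<close> no neighbor is lower still. So a neighbor minimizing the level lies
  exactly one level below \<open>v\<close>.\<close>

lemma adj_parent_vlen: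
  assumes "v \<noteq> root"
  shows "adj v (parent v) \<and> vlen v = Suc (vlen (parent v))"
proof -
  obtain p where p: "simple_path root v p" using simple_path_exists by blast
  define q where "q = butlast p"
  have pq: "p = q @ [v]" using p by (metis q_def append_butlast_last_id simple_path_def)
  with p assms have q: "q \<noteq> []" by (auto simp: simple_path_def)
  have w: "simple_path root (last q) q" "adj (last q) v"
    using p q unfolding pq by (auto simp: simple_path_def successively_append_iff)
  have len: "vlen v = Suc (vlen (last q))"
    using vlen_eq[OF p] vlen_eq[OF w(1)] pq q by (cases q) auto
  have arg_min: "adj v (parent v) \<and> (\<forall>w. adj v w \<longrightarrow> vlen (parent v) \<le> vlen w)"
    unfolding parent_def using w(2) symmetric by (intro arg_min_nat_lemma) blast
  then have "vlen (parent v) \<le> vlen (last q)" "vlen v \<le> Suc (vlen (parent v))"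
    using symmetric[OF w(2)] vlen_adj_le[OF symmetric] by blast+
  then show ?thesis using arg_min len by simp
qed

lemma parent_induct [case_names root parent]:
  assumes "P root" and "\<And>v. v \<noteq> root \<Longrightarrow> P (parent v) \<Longrightarrow> P v"
  shows "P v"
proof (induction "vlen v" arbitrary: v rule: less_induct)
  case less
  then show ?case using assms adj_parent_vlen by (metis lessI)
qed


section \<open>Lipschitz spaces\<close>

text \<open>A general weight covers both Lipschitz spaces, so the norm axioms are proved
  once.\<close>

definition wspace :: "('v \<Rightarrow> real) \<Rightarrow> ('v \<Rightarrow> complex) set" where
  "wspace w = {f. bdd_above ((\<lambda>v. w v * D f v) ` (UNIV - {root}))}"

definition wnorm :: "('v \<Rightarrow> real) \<Rightarrow> ('v \<Rightarrow> complex) \<Rightarrow> real" where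
  "wnorm w f = cmod (f root) + (SUP v\<in>UNIV - {root}. w v * D f v)"

lemma lipschitz_eq_wspace:
  "lipschitz_space = wspace (\<lambda>_. 1)" "lipschitz_norm = wnorm (\<lambda>_. 1)"
  by (auto simp: lipschitz_space_def lipschitz_norm_def wspace_def wnorm_def)

lemma weighted_lipschitz_eq_wspace:
  "weighted_lipschitz_space = wspace (\<lambda>v. real (vlen v))"
  "weighted_lipschitz_norm = wnorm (\<lambda>v. real (vlen v))"
  by (auto simp: weighted_lipschitz_space_def weighted_lipschitz_norm_def wspace_def wnorm_def)

text \<open>Ensures that the suprema in the norms do not range over the empty set.\<close>

lemma nonroot_nonempty: "UNIV - {root} \<noteq> {}"
  using infinite_vertices by (metis Diff_eq_empty_iff finite.emptyI finite_insert finite_subset)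

lemma D_nonneg: "0 \<le> D f v"
  by (simp add: D_def)

lemma wspaceI:
  assumes "\<And>v. v \<noteq> root \<Longrightarrow> w v * D f v \<le> C"
  shows "f \<in> wspace w" "wnorm w f \<le> cmod (f root) + C"
proof -
  show "f \<in> wspace w" using assms by (auto simp: wspace_def bdd_above_def)
  have "(SUP v\<in>UNIV - {root}. w v * D f v) \<le> C"
    using assms nonroot_nonempty by (intro cSUP_least) auto
  then show "wnorm w f \<le> cmod (f root) + C" by (simp add: wnorm_def)
qed

lemma wspace_le:
  assumes "f \<in> wspace w" "v \<noteq> root"
  shows "cmod (f root) + w v * D f v \<le> wnorm w f"
  using assms by (auto simp: wspace_def wnorm_def intro!: cSUP_upper)

text \<open>The seminorm axioms pass from \<open>D\<close> to the supremum. Definiteness uses the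
  tree: norm zero forces value zero at the root and, the weights being positive, no change along any
  edge.\<close>

lemma normed_function_space_wspace:
  assumes w: "\<And>v. v \<noteq> root \<Longrightarrow> 0 < w v"
  shows "normed_function_space (wspace w) (wnorm w)"
proof
  show zero: "(\<lambda>_. 0) \<in> wspace w"
    by (rule wspaceI(1)[of _ _ 0]) (simp add: D_def)
  have add: "(\<lambda>v. f v + g v) \<in> wspace w \<and> wnorm w (\<lambda>v. f v + g v) \<le> wnorm w f + wnorm w g"
    if f: "f \<in> wspace w" and g: "g \<in> wspace w" for f g
  proof -
    \<comment> \<open>Each difference is the supremum part of the norm.\<close>
    let ?C = "(wnorm w f - cmod (f root)) + (wnorm w g - cmod (g root))"
    have *: "w v * D (\<lambda>v. f v + g v) v \<le> ?C" if v: "v \<noteq> root" for v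
    proof -
      have "D (\<lambda>v. f v + g v) v \<le> D f v + D g v"
        unfolding D_def by (metis add_diff_add norm_triangle_ineq)
      then have "w v * D (\<lambda>v. f v + g v) v \<le> w v * (D f v + D g v)"
        using w[OF v] by (intro mult_left_mono) auto
      then show ?thesis using wspace_le[OF f v] wspace_le[OF g v] by (simp add: algebra_simps)
    qed
    have "cmod (f root + g root) \<le> cmod (f root) + cmod (g root)" by (rule norm_triangle_ineq)
    with wspaceI(1)[where C = ?C, OF *] wspaceI(2)[where C = ?C, OF *] show ?thesis by simp
  qed
  then show "\<And>f g. f \<in> wspace w \<Longrightarrow> g \<in> wspace w \<Longrightarrow> (\<lambda>v. f v + g v) \<in> wspace w"
    and "\<And>f g. f \<in> wspace w \<Longrightarrow> g \<in> wspace w \<Longrightarrow> wnorm w (\<lambda>v. f v + g v) \<le> wnorm w f + wnorm w g"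
    by blast+
  have scale: "(\<lambda>v. c * f v) \<in> wspace w \<and> wnorm w (\<lambda>v. c * f v) \<le> cmod c * wnorm w f"
    if f: "f \<in> wspace w" for f c
  proof -
    let ?C = "cmod c * (wnorm w f - cmod (f root))"
    have *: "w v * D (\<lambda>v. c * f v) v \<le> ?C" if v: "v \<noteq> root" for v
    proof -
      have "D (\<lambda>v. c * f v) v = cmod c * D f v"
        unfolding D_def by (metis norm_mult right_diff_distrib)
      moreover have "cmod c * (w v * D f v) \<le> ?C"
        using wspace_le[OF f v] by (intro mult_left_mono) auto
      ultimately show ?thesis by (simp add: mult_ac)
    qed
    from wspaceI(1)[where C = ?C, OF *] wspaceI(2)[where C = ?C, OF *] show ?thesis
      by (simp add: norm_mult algebra_simps)
  qed
  then show "\<And>f c. f \<in> wspace w \<Longrightarrow> (\<lambda>v. c * f v) \<in> wspace w"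
    and "\<And>f c. f \<in> wspace w \<Longrightarrow> wnorm w (\<lambda>v. c * f v) \<le> cmod c * wnorm w f"
    by blast+
  show "f = (\<lambda>_. 0)" if f: "f \<in> wspace w" and le: "wnorm w f \<le> 0" for f
  proof
    \<comment> \<open>Some vertex off the root is needed to read off the root value from
      \<open>wspace_le\<close>.\<close>
    obtain v\<^sub>0 where v\<^sub>0: "v\<^sub>0 \<noteq> root" using nonroot_nonempty by blast
    have nn: "0 \<le> w v * D f v" if "v \<noteq> root" for v
      using w[OF that] D_nonneg[of f v] by simp
    fix v show "f v = 0"
    proof (induction v rule: parent_induct)
      case root
      have "cmod (f root) \<le> 0" using wspace_le[OF f v\<^sub>0] nn[OF v\<^sub>0] le by linarith
      then show ?case by simp
    next
      case (parent v)
      have "w v * D f v \<le> 0"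
        using wspace_le[OF f parent(1)] le norm_ge_zero[of "f root"] by linarith
      with nn[OF parent(1)] w[OF parent(1)] have "D f v = 0" by (simp add: mult_le_0_iff)
      then show ?case using parent(2) by (simp add: D_def)
    qed
  qed
qed

section \<open>Radial test functions\<close>

text \<open>Since a profile is available beyond every level \<open>m\<close>, each new one can start
  where the previous one has ended.\<close>

lemma essential_norm_ge_radial:
  assumes M: "bounded_operator lipschitz_space lipschitz_norm
      weighted_lipschitz_space weighted_lipschitz_norm (mult_operator \<psi>)"
    and profile: "\<And>m :: nat. \<exists>h N v. v \<noteq> root \<and> m < N \<and> (\<forall>k\<le>m. h k = 0) \<and> (\<forall>k\<ge>N. h k = 0) \<and>
      (\<forall>k. \<bar>h (Suc k) - h k\<bar> \<le> (1 :: real)) \<and>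
      L \<le> real (vlen v) * D (mult_operator \<psi> (\<lambda>u. of_real (h (vlen u)))) v"
  shows "L \<le> essential_norm lipschitz_space lipschitz_norm
      weighted_lipschitz_space weighted_lipschitz_norm (mult_operator \<psi>)"
proof -
  obtain H N V where V: "\<And>m. V m \<noteq> root" and N: "\<And>m. m < N m"
    and H0: "\<And>m k. k \<le> m \<Longrightarrow> H m k = 0" "\<And>m k. k \<ge> N m \<Longrightarrow> H m k = 0"
    and H1: "\<And>m k. \<bar>H m (Suc k) - H m k\<bar> \<le> (1 :: real)"
    and HL: "\<And>m. L \<le> real (vlen (V m)) * D (mult_operator \<psi> (\<lambda>u. of_real (H m (vlen u)))) (V m)"
    using profile by metis
  \<comment> \<open>Iterating \<open>N\<close> from level 0 yields the consecutive ranges: the n-th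
    profile lives strictly between levels \<open>r n\<close> and \<open>r (Suc n)\<close>.\<close>
  define r where "r n = (N ^^ n) 0" for n
  have r_Suc: "r (Suc n) = N (r n)" for n by (simp add: r_def)
  have "strict_mono r" unfolding strict_mono_Suc_iff by (simp add: r_Suc N)
  then have r_mono: "r i \<le> r j" if "i \<le> j" for i j
    using that by (simp add: strict_mono_less_eq)
  define f :: "nat \<Rightarrow> 'v \<Rightarrow> complex" where "f n = (\<lambda>u. of_real (H (r n) (vlen u)))" for n
  \<comment> \<open>Each edge meets at most one profile that varies along it, so finite sums keep
    slope at most 1. The factor 1 is the weight of the Lipschitz space in
    \<open>wspace\<close>.\<close>
  have sum_D: "1 * D (\<lambda>u. \<Sum>n\<in>I. f n u) v \<le> 1" if I: "finite I" and v: "v \<noteq> root" for I v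
  proof -
    define k where "k = vlen (parent v)"
    define a where "a n = H (r n) (Suc k) - H (r n) k" for n
    have "vlen v = Suc k" using adj_parent_vlen[OF v] by (simp add: k_def)
    then have "(\<Sum>n\<in>I. f n v) - (\<Sum>n\<in>I. f n (parent v)) = of_real (\<Sum>n\<in>I. a n)"
      by (simp add: f_def a_def sum_subtractf flip: k_def)
    then have D_eq: "D (\<lambda>u. \<Sum>n\<in>I. f n u) v = \<bar>\<Sum>n\<in>I. a n\<bar>"
      by (simp add: D_def del: of_real_sum)
    have support: "r n \<le> k \<and> k < r (Suc n)" if "a n \<noteq> 0" for n
    proof (rule ccontr)
      \<comment> \<open>Otherwise both ends of the edge lie at levels where the profile vanishes;
        the boundary levels are included.\<close>
      assume "\<not> ?thesis"
      then consider "Suc k \<le> r n" | "N (r n) \<le> k" unfolding r_Suc by linarith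
      then have "a n = 0" by cases (auto simp: a_def H0)
      with that show False by simp
    qed
    have unique: "i = j" if "a i \<noteq> 0" "a j \<noteq> 0" for i j
      using support[OF that(1)] support[OF that(2)] r_mono[of "Suc i" j] r_mono[of "Suc j" i]
      by (cases i j rule: linorder_cases) auto
    have "\<bar>\<Sum>n\<in>I. a n\<bar> \<le> 1"
    proof (cases "\<exists>j\<in>I. a j \<noteq> 0")
      case True
      then obtain j where j: "j \<in> I" "a j \<noteq> 0" by blast
      then have "(\<Sum>n\<in>I. a n) = (\<Sum>n\<in>{j}. a n)"
        using I unique by (intro sum.mono_neutral_right) auto
      then show ?thesis using H1 by (simp add: a_def)
    qed simp
    then show ?thesis by (simp add: D_eq)
  qed
  \<comment> \<open>All profiles vanish at level 0, so the norm is just the supremum of the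
    derivatives.\<close>
  have "(\<Sum>n\<in>I. f n root) = 0" for I
    by (simp add: f_def vlen_root H0)
  then have norm_sum: "lipschitz_norm (\<lambda>u. \<Sum>n\<in>I. f n u) \<le> 1" if "finite I" for I
    unfolding lipschitz_eq_wspace using wspaceI(2)[of "\<lambda>_. 1", OF sum_D[OF that]] by simp
  have f_mem: "f n \<in> lipschitz_space" for n
    unfolding lipschitz_eq_wspace using wspaceI(1)[of "\<lambda>_. 1", OF sum_D[of "{n}"]] by simp
  show ?thesis
  proof (rule essential_norm_ge[OF _ _ M])
    show "normed_function_space lipschitz_space lipschitz_norm"
      unfolding lipschitz_eq_wspace by (rule normed_function_space_wspace) simp
    show "normed_function_space weighted_lipschitz_space weighted_lipschitz_norm"
      unfolding weighted_lipschitz_eq_wspace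
      by (rule normed_function_space_wspace) (use adj_parent_vlen in fastforce)
    show "f n \<in> lipschitz_space" for n by (rule f_mem)
    show "lipschitz_norm (f n) \<le> 1" for n using norm_sum[of "{n}"] by simp
    show "lipschitz_norm (\<lambda>u. \<Sum>n\<in>I. f n u) \<le> 1" if "finite I" for I
      by (rule norm_sum[OF that])
    show "L \<le> weighted_lipschitz_norm (mult_operator \<psi> (f n))" for n
    proof -
      have "mult_operator \<psi> (f n) \<in> weighted_lipschitz_space"
        using M f_mem unfolding bounded_operator_def linear_operator_def by blast
      from wspace_le[OF this[unfolded weighted_lipschitz_eq_wspace] V[of "r n"]]
      have "real (vlen (V (r n))) * D (mult_operator \<psi> (f n)) (V (r n))
          \<le> weighted_lipschitz_norm (mult_operator \<psi> (f n))"
        unfolding weighted_lipschitz_eq_wspace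
        using norm_ge_zero[of "mult_operator \<psi> (f n) root"] by linarith
      with HL[of "r n"] show ?thesis by (simp add: f_def)
    qed
  qed
qed

section \<open>The bounds by \<A> and by half of \<B>\<close>

lemma less_lim_SUP_levels:
  fixes g :: "'v \<Rightarrow> real"
  assumes "ereal L < lim (\<lambda>n. SUP v\<in>{v. vlen v \<ge> n}. ereal (g v))"
  shows "\<exists>v. m \<le> vlen v \<and> L < g v"
proof -
  let ?s = "\<lambda>n. SUP v\<in>{v. vlen v \<ge> n}. ereal (g v)"
  \<comment> \<open>The suprema decrease, so their limit is their infimum and lies below each of
    them.\<close>
  have "decseq ?s" by (intro decseq_SucI SUP_subset_mono) auto
  then have "lim ?s = (INF n. ?s n)" by (intro limI LIMSEQ_INF)
  also have "\<dots> \<le> ?s m" by (intro INF_lower) simp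
  finally have "ereal L < ?s m" using assms by order
  then show ?thesis by (auto simp: less_SUP_iff)
qed

lemma essential_norm_ge_\<A>:
  assumes "bounded_operator lipschitz_space lipschitz_norm
      weighted_lipschitz_space weighted_lipschitz_norm (mult_operator \<psi>)"
  shows "\<A> \<psi> \<le> ereal (essential_norm lipschitz_space lipschitz_norm
      weighted_lipschitz_space weighted_lipschitz_norm (mult_operator \<psi>))" (is "_ \<le> ereal ?e")
proof (rule ccontr)
  assume "\<not> ?thesis"
  \<comment> \<open>A real \<open>L\<close> strictly in between reduces the extended real claim,
    where \<A> could a priori be infinite, to real inequalities.\<close>
  then obtain L where L: "?e < L" "ereal L < \<A> \<psi>"
    using ereal_dense2[of "ereal ?e" "\<A> \<psi>"] by (auto simp: not_le)
  have "L \<le> ?e"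
  proof (rule essential_norm_ge_radial[OF assms])
    fix m
    \<comment> \<open>The level must exceed \<open>m\<close>, where the profile has to
      vanish.\<close>
    obtain v where v: "Suc m \<le> vlen v" "L < real (vlen v) * cmod (\<psi> v)"
      using less_lim_SUP_levels[OF L(2)[unfolded \<A>_def]] by blast
    let ?h = "\<lambda>k. if k = vlen v then 1 else 0 :: real"
    have root: "v \<noteq> root" using v(1) vlen_root by auto
    then have "vlen (parent v) \<noteq> vlen v" using adj_parent_vlen by fastforce
    then have "D (mult_operator \<psi> (\<lambda>u. of_real (?h (vlen u)))) v = cmod (\<psi> v)"
      by (simp add: D_def mult_operator_def)
    then have "L \<le> real (vlen v) * D (mult_operator \<psi> (\<lambda>u. of_real (?h (vlen u)))) v"
      using v(2) by simp
    with root v(1) show "\<exists>h N v. v \<noteq> root \<and> m < N \<and> (\<forall>k\<le>m. h k = 0) \<and> (\<forall>k\<ge>N. h k = 0) \<and>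
      (\<forall>k. \<bar>h (Suc k) - h k\<bar> \<le> (1 :: real)) \<and>
      L \<le> real (vlen v) * D (mult_operator \<psi> (\<lambda>u. of_real (h (vlen u)))) v"
      by (intro exI[of _ ?h] exI[of _ "Suc (vlen v)"] exI[of _ v]) auto
  qed
  with L(1) show False by simp
qed

lemma essential_norm_ge_half_\<B>:
  assumes "bounded_operator lipschitz_space lipschitz_norm
      weighted_lipschitz_space weighted_lipschitz_norm (mult_operator \<psi>)"
  shows "1/2 * \<B> \<psi> \<le> ereal (essential_norm lipschitz_space lipschitz_norm
      weighted_lipschitz_space weighted_lipschitz_norm (mult_operator \<psi>))" (is "_ \<le> ereal ?e")
proof (rule ccontr)
  assume "\<not> ?thesis"
  then obtain L where L: "?e < L" "ereal L < 1/2 * \<B> \<psi>"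
    using ereal_dense2[of "ereal ?e" "1/2 * \<B> \<psi>"] by (auto simp: not_le)
  \<comment> \<open>Clearing the factor 1/2 makes the extraction of a vertex applicable to \<B>
    itself.\<close>
  have L2: "ereal (2 * L) < \<B> \<psi>"
  proof (rule ccontr)
    assume "\<not> ?thesis"
    then have "ereal (1/2) * \<B> \<psi> \<le> ereal (1/2) * ereal (2 * L)"
      by (intro ereal_mult_left_mono) auto
    moreover have "ereal (1/2) = 1/2" by (simp add: one_ereal_def numeral_eq_ereal)
    ultimately show False using L(2) by simp
  qed
  have "L \<le> ?e"
  proof (rule essential_norm_ge_radial[OF assms])
    fix m
    \<comment> \<open>This is exactly the condition for the height \<open>c\<close> below to be at
      least half the level of \<open>v\<close>.\<close>
    obtain v where v: "2 * m + 2 \<le> vlen v" "2 * L < (real (vlen v))\<^sup>2 * D \<psi> v"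
      using less_lim_SUP_levels[OF L2[unfolded \<B>_def]] by blast
    define k where "k = vlen v"
    \<comment> \<open>The profile rises with slope 1 from level \<open>m\<close>, reaches
      \<open>c\<close> at level \<open>k - 1\<close>, keeps it at level \<open>k\<close>, and falls
      to zero at level \<open>k + c\<close>. Truncated subtraction gives the zeros outside this
      range.\<close>
    define c where "c = k - 1 - m"
    define h where "h j = real (min (min (j - m) c) (k + c - j))" for j
    have root: "v \<noteq> root" using v(1) vlen_root by auto
    then have "vlen (parent v) = k - 1" using adj_parent_vlen by (fastforce simp: k_def)
    then have "D (mult_operator \<psi> (\<lambda>u. of_real (h (vlen u)))) v = cmod ((\<psi> v - \<psi> (parent v)) * of_nat c)"
      using v(1) by (simp add: D_def mult_operator_def h_def c_def k_def algebra_simps)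
    then have D_eq: "D (mult_operator \<psi> (\<lambda>u. of_real (h (vlen u)))) v = real c * D \<psi> v"
      by (simp add: D_def norm_mult)
    have "real k / 2 \<le> real c" using v(1) by (simp add: c_def k_def)
    then have "real k / 2 * (real k * D \<psi> v) \<le> real c * (real k * D \<psi> v)"
      by (rule mult_right_mono) (simp add: D_nonneg)
    then have "L \<le> real (vlen v) * D (mult_operator \<psi> (\<lambda>u. of_real (h (vlen u)))) v"
      using v(2) by (simp add: D_eq power2_eq_square mult_ac flip: k_def)
    moreover have "\<bar>h (Suc j) - h j\<bar> \<le> 1" for j
      unfolding h_def by linarith
    moreover have "h j = 0" if "j \<le> m" for j using that by (simp add: h_def)
    moreover have "h j = 0" if "j \<ge> k + c" for j using that by (simp add: h_def)
    moreover have "m < k + c" using v(1) by (simp add: k_def)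
    ultimately show "\<exists>h N v. v \<noteq> root \<and> m < N \<and> (\<forall>k\<le>m. h k = 0) \<and> (\<forall>k\<ge>N. h k = 0) \<and>
      (\<forall>k. \<bar>h (Suc k) - h k\<bar> \<le> (1 :: real)) \<and>
      L \<le> real (vlen v) * D (mult_operator \<psi> (\<lambda>u. of_real (h (vlen u)))) v"
      using root by (intro exI[of _ h] exI[of _ "k + c"] exI[of _ v]) auto
  qed
  with L(1) show False by simp
qed

end

theorem theorem3p5:
  fixes adj :: "'v \<Rightarrow> 'v \<Rightarrow> bool" and root :: 'v and \<psi> :: "'v \<Rightarrow> complex"
  assumes "leafless_tree adj"
    and "bounded_operator
           (rooted_tree.lipschitz_space adj root) (rooted_tree.lipschitz_norm adj root)
           (rooted_tree.weighted_lipschitz_space adj root) (rooted_tree.weighted_lipschitz_norm adj root)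
           (mult_operator \<psi>)"
  shows "ereal (essential_norm
           (rooted_tree.lipschitz_space adj root) (rooted_tree.lipschitz_norm adj root)
           (rooted_tree.weighted_lipschitz_space adj root) (rooted_tree.weighted_lipschitz_norm adj root)
           (mult_operator \<psi>))
         \<ge> max (rooted_tree.\<A> adj root \<psi>) (1/2 * rooted_tree.\<B> adj root \<psi>)"
proof -
  interpret rooted_tree adj root using assms(1) by (rule rooted_tree.intro)
  show ?thesis
    using essential_norm_ge_\<A>[OF assms(2)] essential_norm_ge_half_\<B>[OF assms(2)] by (rule max.boundedI)
qed

end
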